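(* Let $m\ge 3$ and $n\ge 1$ be integers, let $P_m$ be the path with $m$ vertices, and let $\mathbf{G}:=P_m^n$ be the $n$-dimensional $m\times\cdots\times m$ grid. Let $\emptyset\neq A\subseteq V(\mathbf{G})$. If $|A|\le(m/e)^n$, then $$e_{\mathbf{G}}(A,A^c)\ge n\cdot|A|^{1-1/n},$$ and if $(m/e)^n\le|A|\le m^n/2$, then $$e_{\mathbf{G}}(A,A^c)\ge\frac{|A|}{m}\cdot e\log\frac{m^n}{|A|}.$$ Here $e$ without a subscript is Euler's number.
   Context: $\log$ is the natural logarithm. For a graph $G$ and $A\subseteq V(G)$, $A^c=V(G)\setminus A$ and $e_G(A,A^c)$ is the number of edges of $G$ with exactly one endpoint in $A$. $G^n$ denotes the product graph $G\square\cdots\square G$ ($n$ copies): its vertex set is $V(G)^n$ and its edges are all pairs $\{u,v\}$ for which there is an index $j\in\{1,\dots,n\}$ such that $u_jv_j\in E(G)$ and $u_l=v_l$ for all $l\neq j$. *)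

theory Defs
  imports "HOL-Analysis.Analysis"
begin

text \<open>An undirected graph: a set of vertices and a set of two-element sets of vertices.\<close>

record 'a graph =
  verts :: "'a set"
  edges :: "'a set set"

definition simple_graph :: "'a graph \<Rightarrow> bool" where
  "simple_graph G \<longleftrightarrow> (\<forall>e\<in>edges G. e \<subseteq> verts G \<and> card e = 2)"

definition path_graph :: "nat \<Rightarrow> nat graph" where
  "path_graph m = \<lparr>verts = {1..m}, edges = {{i, i + 1} | i. 1 \<le> i \<and> i + 1 \<le> m}\<rparr>"

text \<open>A vertex of the \<open>n\<close>-fold product is an extensional function on \<open>{1..n}\<close> (with value
  \<open>undefined\<close> elsewhere), so that distinct functions are distinct \<open>n\<close>-tuples.\<close>

definition graph_power :: "'a graph \<Rightarrow> nat \<Rightarrow> (nat \<Rightarrow> 'a) graph" where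
  "graph_power G n =
     \<lparr>verts = {1..n} \<rightarrow>\<^sub>E verts G,
      edges = {{u, v} | u v. u \<in> ({1..n} \<rightarrow>\<^sub>E verts G) \<and> v \<in> ({1..n} \<rightarrow>\<^sub>E verts G) \<and>
                 (\<exists>j\<in>{1..n}. {u j, v j} \<in> edges G \<and> (\<forall>l\<in>{1..n}. l \<noteq> j \<longrightarrow> u l = v l))}\<rparr>"

text \<open>The number \<open>e\<^sub>G(A, A\<^sup>c)\<close>, where the complement is taken in the vertex set of \<open>G\<close>.\<close>

definition edge_boundary :: "'a graph \<Rightarrow> 'a set \<Rightarrow> nat" where
  "edge_boundary G A = card {e \<in> edges G. \<exists>u\<in>A. \<exists>v\<in>verts G - A. e = {u, v}}"

lemma simple_graph_path_graph: "simple_graph (path_graph m)"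
  by (auto simp: simple_graph_def path_graph_def)

lemma simple_graph_graph_power:
  assumes "simple_graph G"
  shows "simple_graph (graph_power G n)"
  unfolding simple_graph_def
proof
  fix e assume "e \<in> edges (graph_power G n)"
  then obtain u v j where e: "e = {u, v}"
    and uv: "u \<in> {1..n} \<rightarrow>\<^sub>E verts G" "v \<in> {1..n} \<rightarrow>\<^sub>E verts G" and j: "{u j, v j} \<in> edges G"
    unfolding graph_power_def by auto
  from assms j have "card {u j, v j} = 2"
    by (auto simp: simple_graph_def)
  then have "u \<noteq> v" by auto
  with e uv show "e \<subseteq> verts (graph_power G n) \<and> card e = 2"
    by (simp add: graph_power_def)
qed

lemma card_verts_grid: "card (verts (graph_power (path_graph m) n)) = m ^ n"
  by (simp add: graph_power_def path_graph_def card_PiE)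

lemma finite_verts_grid: "finite (verts (graph_power (path_graph m) n))"
  by (auto simp: graph_power_def path_graph_def intro: finite_PiE)

lemma finite_edges_grid: "finite (edges (graph_power (path_graph m) n))"
proof (rule finite_subset)
  show "edges (graph_power (path_graph m) n) \<subseteq> Pow (verts (graph_power (path_graph m) n))"
    using simple_graph_graph_power[OF simple_graph_path_graph, of m n]
    by (auto simp: simple_graph_def)
qed (simp add: finite_verts_grid)

end

(* Let X be uniform on A and let a_i(x) be the number of points of A on the line through x in
   direction i.  Comparing the chain rule for the entropy of X with conditioning each coordinate
   on all others gives \<Sum>_i \<Sum>_x ln (a_i(x)) \<le> |A| ln |A|.  On the other hand ln z \<le> z - 1 gives
   ln (m/a) \<le> (m/a) exp (-t) + t - 1 for every t, and for t \<ge> 1 the first summand can be dropped on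
   lines contained in A.  Every other line that meets A carries a boundary edge, so summation yields
   |A| (L - n (t - 1)) \<le> m exp (-t) e(A, A^c)  with  L = ln (m^n / |A|).
   The two bounds are t = L/n (allowed when |A| \<le> (m/e)^n) and t = 1. *)
theory Submission
  imports Defs
begin

section \<open>Lines, cylinders and the entropy inequality\<close>

text \<open>For X uniform on \<open>A\<close>, this is the set on which X is uniform once its
  coordinates in \<open>J\<close> are known to agree with \<open>x\<close>. Hence the average of
  \<open>ln (card (cylinder A J x))\<close> over \<open>A\<close> is the conditional entropy H(X |
  X_J).\<close>

definition cylinder :: "('i \<Rightarrow> 'a) set \<Rightarrow> 'i set \<Rightarrow> ('i \<Rightarrow> 'a) \<Rightarrow> ('i \<Rightarrow> 'a) set" where
  "cylinder A J x = {y \<in> A. \<forall>l\<in>J. y l = x l}"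

abbreviation line :: "('i \<Rightarrow> 'a) set \<Rightarrow> 'i \<Rightarrow> ('i \<Rightarrow> 'a) \<Rightarrow> ('i \<Rightarrow> 'a) set" where
  "line A i x \<equiv> cylinder A (- {i}) x"

lemma finite_cylinder: "finite A \<Longrightarrow> finite (cylinder A J x)"
  by (simp add: cylinder_def)

lemma self_in_cylinder: "x \<in> A \<Longrightarrow> x \<in> cylinder A J x"
  by (simp add: cylinder_def)

lemma cylinder_cong: "(\<And>l. l \<in> J \<Longrightarrow> x l = y l) \<Longrightarrow> cylinder A J x = cylinder A J y"
  by (auto simp: cylinder_def)

lemma card_cylinder_pos: "finite A \<Longrightarrow> x \<in> A \<Longrightarrow> 0 < card (cylinder A J x)"
  using self_in_cylinder[of x A J] finite_cylinder[of A J x] by (auto simp: card_gt_0_iff)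

text \<open>Double counting behind H(X_i | all other coordinates) \<le> H(X_i | X_J): these
  entropies are the averages of \<open>ln\<close> of the line size and of \<open>ln\<close> of the
  quotient of the two cylinder sizes, so each summand is the ratio to which ln z \<le> z - 1 will be
  applied.\<close>

lemma sum_line_cylinder_le:
  fixes A :: "('i \<Rightarrow> 'a) set"
  assumes A: "finite A" and i: "i \<notin> J"
  shows "(\<Sum>x\<in>A. real (card (line A i x)) * real (card (cylinder A (insert i J) x))
            / real (card (cylinder A J x))) \<le> real (card A)"
proof -
  \<comment> \<open>Elements are triples (x, (y, z)): y shares with x the coordinates in
    \<open>insert i J\<close>, z shares all coordinates except i.\<close>
  define T where "T = (SIGMA x:A. cylinder A (insert i J) x \<times> line A i x)"
  define U where "U = (SIGMA y:A. cylinder A J y)"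
  define w where "w y = 1 / real (card (cylinder A J y))" for y
  have finU: "finite U"
    using A by (auto simp: U_def finite_cylinder)
  have "(\<Sum>x\<in>A. real (card (line A i x)) * real (card (cylinder A (insert i J) x))
            / real (card (cylinder A J x))) =
        (\<Sum>x\<in>A. \<Sum>p\<in>cylinder A (insert i J) x \<times> line A i x. w x)"
    by (simp add: card_cartesian_product w_def mult.commute)
  also have "\<dots> = (\<Sum>q\<in>T. w (fst q))"
    unfolding T_def using A by (subst sum.Sigma) (auto simp: finite_cylinder split_def)
  also have "\<dots> = (\<Sum>q\<in>T. w (fst (snd q)))"
  proof (rule sum.cong)
    fix q assume "q \<in> T"
    then have "cylinder A J (fst q) = cylinder A J (fst (snd q))"
      by (intro cylinder_cong) (auto simp: T_def cylinder_def)
    then show "w (fst q) = w (fst (snd q))"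
      by (simp add: w_def)
  qed simp
  also have "\<dots> = (\<Sum>p\<in>snd ` T. w (fst p))"
  proof (rule sum.reindex_cong[symmetric, where l = snd])
    show "inj_on snd T"
    proof (rule inj_onI)
      fix q q' assume "q \<in> T" "q' \<in> T" "snd q = snd q'"
      \<comment> \<open>The pair (y, z) determines x: take z and replace its coordinate i by that of
        y.\<close>
      moreover have "fst r = (snd (snd r))(i := fst (snd r) i)" if "r \<in> T" for r
        using that by (auto simp: T_def cylinder_def fun_eq_iff)
      ultimately show "q = q'"
        by (metis prod.collapse)
    qed
  qed auto
  also have "\<dots> \<le> (\<Sum>p\<in>U. w (fst p))"
  proof (rule sum_mono2[OF finU])
    \<comment> \<open>Both y and z agree with x on \<open>J\<close>; for z this uses that i lies
      outside \<open>J\<close>.\<close>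
    show "snd ` T \<subseteq> U"
      using i by (auto simp: T_def U_def cylinder_def)
  qed (simp add: w_def)
  also have "\<dots> = (\<Sum>y\<in>A. \<Sum>z\<in>cylinder A J y. w y)"
    unfolding U_def using A by (subst sum.Sigma) (auto simp: finite_cylinder split_def)
  also have "\<dots> = (\<Sum>y\<in>A. 1)"
    using card_cylinder_pos[OF A] by (intro sum.cong) (auto simp: w_def)
  finally show ?thesis by simp
qed

text \<open>Chain rule as an induction on the set of revealed coordinates: the second sum is the
  entropy still left given X_J. Revealing i lowers it by at least the line term of direction i, and
  for empty \<open>J\<close> the cylinder is all of \<open>A\<close>.\<close>

lemma sum_ln_line_cylinder_le:
  assumes A: "finite A" and J: "finite J"
  shows "(\<Sum>i\<in>J. \<Sum>x\<in>A. ln (real (card (line A i x))))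
           + (\<Sum>x\<in>A. ln (real (card (cylinder A J x)))) \<le> real (card A) * ln (real (card A))"
  using J
proof (induction J rule: finite_induct)
  case empty
  then show ?case by (simp add: cylinder_def)
next
  case (insert i J)
  let ?a = "\<lambda>x. real (card (line A i x))"
    and ?c = "\<lambda>x. real (card (cylinder A J x))"
    and ?d = "\<lambda>x. real (card (cylinder A (insert i J) x))"
  have "(\<Sum>x\<in>A. ln (?a x) + ln (?d x) - ln (?c x)) \<le> (\<Sum>x\<in>A. ?a x * ?d x / ?c x - 1)"
  proof (rule sum_mono)
    fix x assume x: "x \<in> A"
    note pos = card_cylinder_pos[OF A x]
    have "ln (?a x) + ln (?d x) - ln (?c x) = ln (?a x * ?d x / ?c x)"
      using pos by (simp add: ln_mult ln_div)
    also have "\<dots> \<le> ?a x * ?d x / ?c x - 1"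
      using pos by (intro ln_le_minus_one) simp
    finally show "ln (?a x) + ln (?d x) - ln (?c x) \<le> ?a x * ?d x / ?c x - 1" .
  qed
  also have "\<dots> \<le> 0"
    using sum_line_cylinder_le[OF A insert.hyps(2)] by (simp add: sum_subtractf)
  finally show ?case
    using insert by (simp add: sum.distrib sum_subtractf)
qed

lemma sum_ln_line_le:
  assumes A: "finite A" and J: "finite J"
  shows "(\<Sum>i\<in>J. \<Sum>x\<in>A. ln (real (card (line A i x)))) \<le> real (card A) * ln (real (card A))"
proof -
  \<comment> \<open>The leftover entropy is nonnegative, as every cylinder contains its own base
    point.\<close>
  have "0 \<le> (\<Sum>x\<in>A. ln (real (card (cylinder A J x))))"
    using card_cylinder_pos[OF A] by (intro sum_nonneg ln_ge_zero) (simp add: Suc_leI)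
  then show ?thesis
    using sum_ln_line_cylinder_le[OF A J] by linarith
qed

section \<open>Boundary edges on lines not contained in A\<close>

lemma exists_consecutive_change:
  fixes P :: "nat \<Rightarrow> bool"
  assumes "a \<le> b" "P a \<noteq> P b"
  shows "\<exists>j. a \<le> j \<and> j + 1 \<le> b \<and> P j \<noteq> P (j + 1)"
  using assms
proof (induction b rule: dec_induct)
  case (step b)
  show ?case
  proof (cases "P a = P b")
    case True
    then show ?thesis
      using step.hyps step.prems by (intro exI[of _ b]) simp
  next
    case False
    then obtain j where "a \<le> j" "j + 1 \<le> b" "P j \<noteq> P (j + 1)"
      using step.IH by blast
    then show ?thesis
      by (intro exI[of _ j]) simp
  qed
qed simp

text \<open>A boundary edge has exactly one orientation that starts in \<open>A\<close>, so nothing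
  is counted twice.\<close>

lemma edge_boundary_eq_card_pairs:
  "edge_boundary G A = card {(u, v). u \<in> A \<and> v \<in> verts G - A \<and> {u, v} \<in> edges G}"
    (is "_ = card ?D")
proof -
  have "{e \<in> edges G. \<exists>u\<in>A. \<exists>v\<in>verts G - A. e = {u, v}} = (\<lambda>(u, v). {u, v}) ` ?D"
    by auto
  moreover have "inj_on (\<lambda>(u, v). {u, v}) ?D"
    by (auto simp: inj_on_def doubleton_eq_iff)
  ultimately show ?thesis
    by (simp add: edge_boundary_def card_image)
qed

definition leaving :: "nat \<Rightarrow> (nat \<Rightarrow> nat) set \<Rightarrow> nat \<Rightarrow> (nat \<Rightarrow> nat) set" where
  "leaving m A i = {x \<in> A. \<exists>k\<in>{1..m}. x(i := k) \<notin> A}"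

text \<open>Walking along the line from \<open>x\<close> to a point outside \<open>A\<close>,
  membership changes between two consecutive points. The last two conjuncts record that the edge
  determines its direction and its line.\<close>

lemma boundary_edge_on_leaving_line:
  assumes A: "A \<subseteq> verts (graph_power (path_graph m) n)" and i: "i \<in> {1..n}"
    and x: "x \<in> leaving m A i"
  shows "\<exists>u v. u \<in> A \<and> v \<in> verts (graph_power (path_graph m) n) - A
            \<and> {u, v} \<in> edges (graph_power (path_graph m) n)
            \<and> {l. u l \<noteq> v l} = {i} \<and> line A i x = line A i u"
proof -
  let ?G = "graph_power (path_graph m) n"
  have V: "verts ?G = {1..n} \<rightarrow>\<^sub>E {1..m}"
    by (simp add: graph_power_def path_graph_def)
  from x obtain k where xA: "x \<in> A" and k: "k \<in> {1..m}" "x(i := k) \<notin> A"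
    by (auto simp: leaving_def)
  have xV: "x \<in> {1..n} \<rightarrow>\<^sub>E {1..m}"
    using A xA V by blast
  then have xi: "x i \<in> {1..m}"
    using i by blast
  have upd: "x(i := j) \<in> verts ?G" if "j \<in> {1..m}" for j
    using that xV i unfolding V by (auto simp: PiE_iff extensional_def)
  let ?P = "\<lambda>j. x(i := j) \<in> A"
  have "?P (x i) \<noteq> ?P k"
    using xA k by simp
  \<comment> \<open>The missing point may lie on either side of \<open>x\<close>, hence
    \<open>min\<close> and \<open>max\<close>.\<close>
  then have "\<exists>j. min (x i) k \<le> j \<and> j + 1 \<le> max (x i) k \<and> ?P j \<noteq> ?P (j + 1)"
    by (intro exists_consecutive_change) (auto simp: min_def max_def)
  then obtain j where j: "1 \<le> j" "j + 1 \<le> m" "?P j \<noteq> ?P (j + 1)"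
    using xi k by (fastforce simp: min_def max_def split: if_splits)
  \<comment> \<open>The two consecutive points are named so that \<open>u\<close> is the one in
    \<open>A\<close>.\<close>
  define u where "u = x(i := if ?P j then j else j + 1)"
  define v where "v = x(i := if ?P j then j + 1 else j)"
  have uA: "u \<in> A" and vA: "v \<in> verts ?G - A"
    using j upd[of j] upd[of "j + 1"] by (auto simp: u_def v_def)
  have "{u i, v i} \<in> edges (path_graph m)"
    using j by (auto simp: u_def v_def path_graph_def doubleton_eq_iff)
  then have "\<exists>j\<in>{1..n}. {u j, v j} \<in> edges (path_graph m) \<and> (\<forall>l\<in>{1..n}. l \<noteq> j \<longrightarrow> u l = v l)"
    by (intro bexI[OF _ i]) (simp add: u_def v_def)
  moreover have "u \<in> {1..n} \<rightarrow>\<^sub>E verts (path_graph m)" "v \<in> {1..n} \<rightarrow>\<^sub>E verts (path_graph m)"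
    using A uA vA by (auto simp: graph_power_def)
  ultimately have "{u, v} \<in> edges ?G"
    unfolding graph_power_def graph.simps by (intro CollectI exI[of _ u] exI[of _ v] conjI refl)
  moreover have "{l. u l \<noteq> v l} = {i}"
    by (auto simp: u_def v_def)
  moreover have "line A i x = line A i u"
    by (rule cylinder_cong) (simp add: u_def)
  ultimately show ?thesis
    using uA vA by blast
qed

text \<open>Sending an oriented boundary edge to its direction and its line covers all pairs of a
  direction and a leaving line.\<close>

lemma card_leaving_lines_le:
  assumes A: "A \<subseteq> verts (graph_power (path_graph m) n)"
  shows "(\<Sum>i\<in>{1..n}. card (line A i ` leaving m A i))
           \<le> edge_boundary (graph_power (path_graph m) n) A"
proof -
  let ?G = "graph_power (path_graph m) n"
  have fA: "finite A"
    using A finite_verts_grid finite_subset by blast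
  define D where "D = {(u, v). u \<in> A \<and> v \<in> verts ?G - A \<and> {u, v} \<in> edges ?G}"
  define g where "g = (\<lambda>(u, v). (the_elem {l. u l \<noteq> v l}, line A (the_elem {l. u l \<noteq> v l}) u))"
  define T where "T = (SIGMA i:{1..n}. line A i ` leaving m A i)"
  have "D \<subseteq> verts ?G \<times> verts ?G"
    using A by (auto simp: D_def)
  then have "finite D"
    by (rule finite_subset) (simp add: finite_verts_grid)
  have "T \<subseteq> g ` D"
  proof clarify
    fix i S assume "(i, S) \<in> T"
    then obtain x where i: "i \<in> {1..n}" and x: "x \<in> leaving m A i" "S = line A i x"
      by (auto simp: T_def)
    from boundary_edge_on_leaving_line[OF A i x(1)] x(2) obtain u v
      where "(u, v) \<in> D" "{l. u l \<noteq> v l} = {i}" "S = line A i u"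
      by (auto simp: D_def)
    then show "(i, S) \<in> g ` D"
      by (intro image_eqI[of _ _ "(u, v)"]) (simp_all add: g_def)
  qed
  then have "card T \<le> card D"
    using \<open>finite D\<close> by (meson card_image_le card_mono finite_imageI le_trans)
  moreover have "card T = (\<Sum>i\<in>{1..n}. card (line A i ` leaving m A i))"
    unfolding T_def using fA by (subst card_SigmaI) (auto simp: leaving_def)
  ultimately show ?thesis
    by (simp add: edge_boundary_eq_card_pairs D_def)
qed

section \<open>Tangent bound for the boundary\<close>

text \<open>The points of \<open>B\<close> on a common line \<open>S\<close> number at most
  \<open>card S\<close> and have weight \<open>1 / card S\<close> each, so every line contributes at
  most 1.\<close>

lemma sum_inverse_card_line_le:
  assumes A: "finite A" and B: "B \<subseteq> A"
  shows "(\<Sum>x\<in>B. 1 / real (card (line A i x))) \<le> real (card (line A i ` B))"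
proof -
  have fB: "finite B"
    using A B finite_subset by blast
  have "(\<Sum>x\<in>B. 1 / real (card (line A i x)))
      = (\<Sum>S\<in>line A i ` B. \<Sum>x\<in>{x \<in> B. line A i x = S}. 1 / real (card (line A i x)))"
    by (rule sum.image_gen[OF fB])
  also have "\<dots> \<le> (\<Sum>S\<in>line A i ` B. 1)"
  proof (rule sum_mono)
    fix S assume "S \<in> line A i ` B"
    then have fS: "finite S"
      using A by (auto simp: finite_cylinder)
    have "{x \<in> B. line A i x = S} \<subseteq> S"
    proof clarify
      fix x assume "x \<in> B"
      then show "x \<in> line A i x"
        using B by (intro self_in_cylinder) blast
    qed
    then have "card {x \<in> B. line A i x = S} \<le> card S"
      by (rule card_mono[OF fS])
    then show "(\<Sum>x\<in>{x \<in> B. line A i x = S}. 1 / real (card (line A i x))) \<le> 1"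
      by (auto simp: divide_le_eq_1)
  qed
  finally show ?thesis by simp
qed

lemma card_full_line_ge:
  assumes A: "finite A" and x: "x \<in> A" "x \<notin> leaving m A i"
  shows "m \<le> card (line A i x)"
proof -
  have "inj_on (\<lambda>k. x(i := k)) {1..m}"
    by (auto simp: inj_on_def dest: fun_upd_eqD)
  moreover have "(\<lambda>k. x(i := k)) ` {1..m} \<subseteq> line A i x"
    using x by (auto simp: leaving_def cylinder_def split: if_splits)
  ultimately show ?thesis
    using card_inj_on_le[of "\<lambda>k. x(i := k)" "{1..m}"] finite_cylinder[OF A] by force
qed

lemma grid_boundary_tangent_bound:
  fixes t :: real
  assumes m: "m \<ge> 1" and A: "A \<subseteq> verts (graph_power (path_graph m) n)" and "A \<noteq> {}" and t: "t \<ge> 1"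
  shows "real (card A) * (ln (real m ^ n / real (card A)) - real n * (t - 1))
           \<le> real m * exp (- t) * real (edge_boundary (graph_power (path_graph m) n) A)"
proof -
  let ?G = "graph_power (path_graph m) n"
  let ?a = "\<lambda>i x. real (card (line A i x))"
  have fA: "finite A"
    using A finite_verts_grid finite_subset by blast
  have cA: "0 < card A"
    using fA \<open>A \<noteq> {}\<close> by (simp add: card_gt_0_iff)
  have point: "ln (real m) - ln (?a i x)
      \<le> (if x \<in> leaving m A i then real m * exp (- t) * (1 / ?a i x) else 0) + (t - 1)"
    if x: "x \<in> A" for i x
  proof (cases "x \<in> leaving m A i")
    case True
    have a: "0 < ?a i x"
      using card_cylinder_pos[OF fA x] by simp
    \<comment> \<open>The tangent inequality is applied at z = m exp (-t) / a, so it is sharp for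
      lines with a = m exp (-t).\<close>
    have "ln (real m) - ln (?a i x) - t = ln (real m * exp (- t) / ?a i x)"
      using a m by (simp add: ln_div ln_mult)
    also have "\<dots> \<le> real m * exp (- t) / ?a i x - 1"
      using a m by (intro ln_le_minus_one) simp
    finally show ?thesis
      using True by simp
  next
    case False
    \<comment> \<open>On a full line the left side is at most 0 and t - 1 is at least 0; this is
      where t \<ge> 1 enters.\<close>
    moreover have "ln (real m) \<le> ln (?a i x)"
      using card_full_line_ge[OF fA x False] m by simp
    ultimately show ?thesis
      using t by simp
  qed
  have dir: "real (card A) * ln (real m) - (\<Sum>x\<in>A. ln (?a i x))
      \<le> real m * exp (- t) * real (card (line A i ` leaving m A i)) + real (card A) * (t - 1)" for i
  proof -
    have sub: "leaving m A i \<subseteq> A"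
      by (auto simp: leaving_def)
    have "real (card A) * ln (real m) - (\<Sum>x\<in>A. ln (?a i x)) = (\<Sum>x\<in>A. ln (real m) - ln (?a i x))"
      by (simp add: sum_subtractf)
    also have "\<dots> \<le> (\<Sum>x\<in>A. (if x \<in> leaving m A i then real m * exp (- t) * (1 / ?a i x) else 0)
        + (t - 1))"
      by (rule sum_mono) (rule point)
    also have "\<dots> = real m * exp (- t) * (\<Sum>x\<in>leaving m A i. 1 / ?a i x) + real (card A) * (t - 1)"
      using fA sub by (simp add: sum.distrib sum.inter_restrict[symmetric] Int_absorb1 sum_distrib_left)
    also have "\<dots> \<le> real m * exp (- t) * real (card (line A i ` leaving m A i))
        + real (card A) * (t - 1)"
      using sum_inverse_card_line_le[OF fA sub, of i] by (simp add: mult_left_mono)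
    finally show ?thesis .
  qed
  \<comment> \<open>The left side is |A| ln (m^n / |A|); the entropy inequality bounds the sum of
    the logarithms of line sizes.\<close>
  have "real n * (real (card A) * ln (real m)) - real (card A) * ln (real (card A))
      \<le> (\<Sum>i\<in>{1..n}. real (card A) * ln (real m) - (\<Sum>x\<in>A. ln (?a i x)))"
    using sum_ln_line_le[OF fA, of "{1..n}"] by (simp add: sum_subtractf)
  also have "\<dots> \<le> (\<Sum>i\<in>{1..n}. real m * exp (- t) * real (card (line A i ` leaving m A i))
      + real (card A) * (t - 1))"
    by (rule sum_mono) (rule dir)
  also have "\<dots> = real m * exp (- t) * real (\<Sum>i\<in>{1..n}. card (line A i ` leaving m A i))
      + real n * (real (card A) * (t - 1))"
    by (simp add: sum.distrib sum_distrib_left)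
  also have "\<dots> \<le> real m * exp (- t) * real (edge_boundary ?G A) + real n * (real (card A) * (t - 1))"
    using card_leaving_lines_le[OF A] by (intro add_right_mono mult_left_mono of_nat_mono) simp_all
  finally show ?thesis
    using m cA by (simp add: ln_div ln_realpow algebra_simps)
qed

section \<open>Choice of t in the two ranges\<close>

theorem mainTheorem8:
  fixes m n :: nat and A :: "(nat \<Rightarrow> nat) set"
  assumes "m \<ge> 3" and "n \<ge> 1"
    and "A \<noteq> {}" and "A \<subseteq> verts (graph_power (path_graph m) n)"
  shows "(real (card A) \<le> (real m / exp 1) ^ n \<longrightarrow>
            real (edge_boundary (graph_power (path_graph m) n) A)
              \<ge> real n * real (card A) powr (1 - 1 / real n)) \<and>
         ((real m / exp 1) ^ n \<le> real (card A) \<and> real (card A) \<le> real m ^ n / 2 \<longrightarrow>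
            real (edge_boundary (graph_power (path_graph m) n) A)
              \<ge> real (card A) / real m * (exp 1 * ln (real m ^ n / real (card A))))"
proof -
  let ?E = "real (edge_boundary (graph_power (path_graph m) n) A)" and ?a = "real (card A)"
  have "finite A"
    using assms(4) finite_verts_grid finite_subset by blast
  then have a: "0 < ?a"
    using \<open>A \<noteq> {}\<close> by (simp add: card_gt_0_iff)
  have m: "0 < real m" and n: "0 < real n"
    using assms by simp_all
  define L where "L = ln (real m ^ n / ?a)"
  have L: "L = real n * ln (real m) - ln ?a"
    using a m by (simp add: L_def ln_div ln_realpow)
  have bound: "?a / real m * (exp t * (L - real n * (t - 1))) \<le> ?E" if "t \<ge> 1" for t
    using grid_boundary_tangent_bound[of m A n t] assms that m
    by (simp add: L_def exp_minus field_simps)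
  have "real n * ?a powr (1 - 1 / real n) \<le> ?E" if small: "?a \<le> (real m / exp 1) ^ n"
  proof -
    \<comment> \<open>In logarithmic form the size hypothesis says exactly that t = L/n is
      admissible.\<close>
    have "ln ?a \<le> ln ((real m / exp 1) ^ n)"
      using a m small by simp
    also have "\<dots> = real n * (ln (real m) - 1)"
      using m by (simp add: ln_realpow ln_div)
    finally have "L / real n \<ge> 1"
      using n by (simp add: L field_simps)
    \<comment> \<open>The choice t = L/n is the critical point of exp t (L - n (t - 1)), whose
      derivative is exp t (L - n t).\<close>
    then have "?a / real m * (exp (L / real n) * (L - real n * (L / real n - 1))) \<le> ?E"
      by (rule bound)
    moreover have "L - real n * (L / real n - 1) = real n"
      using n by (simp add: field_simps)
    moreover have "exp (L / real n) = real m * ?a powr (- (1 / real n))"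
    proof -
      have "exp (L / real n) = exp (ln (real m)) * exp (- (1 / real n) * ln ?a)"
        using n by (simp add: L exp_add[symmetric] field_simps)
      then show ?thesis
        using a m by (simp add: powr_def)
    qed
    moreover have "?a powr (1 - 1 / real n) = ?a * ?a powr (- (1 / real n))"
      using a powr_add[of ?a 1 "- (1 / real n)"] by simp
    ultimately show ?thesis
      using m by (simp add: mult_ac)
  qed
  \<comment> \<open>For |A| \<ge> (m/e)^n one has L/n \<le> 1, so t = 1 is the best admissible
    value; there the correction n (t - 1) vanishes.\<close>
  moreover have "?a / real m * (exp 1 * ln (real m ^ n / ?a)) \<le> ?E"
    using bound[of 1] by (simp add: L_def)
  ultimately show ?thesis by blast
qed

end
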